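(* The Collect-based Causal Monitor algorithm is not sequentially consistent with respect to the sequential specification of the Causal Monitor, hence not linearizable: there exist a number $N$ of processes and a well-formed history $H$ produced by the algorithm for which no legal sequential history of the Causal Monitor is equivalent to a completion of $H$ and respects program order.
   Context: **Model.** $N$ asynchronous processes $p_1,\dots,p_N$, each executing its operations sequentially, communicate through atomic shared memory. A history is a finite sequence of invocation and response events; it is well-formed if every response is preceded by its matching invocation; an operation is pending if it has been invoked but has not responded. $\mathit{op}_1<_H\mathit{op}_2$ iff the response of $\mathit{op}_1$ occurs before the invocation of $\mathit{op}_2$. **Correctness conditions.** A sequential specification is a prefix-closed set of sequential histories, called legal. An implementation is sequentially consistent if for every well-formed history $H$ it produces there is a legal sequential history $S$ equivalent to some completion of $H$ (every completed operation appears in $S$; pending operations may be dropped or completed) such that for each process $p_i$ the operations of $p_i$ appear in $S$ in the same order as in $H$. It is linearizable if moreover such an $S$ can be chosen so that $\mathit{op}_1<_H\mathit{op}_2$ implies $\mathit{op}_1<_S\mathit{op}_2$. **Causal Monitor (sequential specification).** Let $\mathcal I$ be a universe of operation identifiers. The abstract state is a sequence $\mathcal S\in(\{I,R\}\times\mathcal I)^*$, initially empty; $\mathrm{idx}(e,\mathcal S)$ is the position of $e$ in $\mathcal S$, or $\infty$ if absent. - $\mathrm{Add\_Inv}(\mathit{id})$ requires $(I,\mathit{id})\notin\mathcal S$ and appends $(I,\mathit{id})$. - $\mathrm{Add\_Res}(\mathit{id})$ requires $(I,\mathit{id})\in\mathcal S$ and $(R,\mathit{id})\notin\mathcal S$,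 and appends $(R,\mathit{id})$. - $\mathrm{Precedes}(\mathit{id}_A,\mathit{id}_B)$ requires $(R,\mathit{id}_A),(R,\mathit{id}_B)\in\mathcal S$, leaves the state unchanged, and returns $\mathtt{true}$ iff $\mathrm{idx}((R,\mathit{id}_A),\mathcal S)<\mathrm{idx}((I,\mathit{id}_B),\mathcal S)$. - $\mathrm{Concurrent}(\mathit{id}_A,\mathit{id}_B)$ has the same requirement, leaves the state unchanged, and returns $\mathtt{true}$ iff $\neg\mathrm{Precedes}(\mathit{id}_A,\mathit{id}_B)\wedge\neg\mathrm{Precedes}(\mathit{id}_B,\mathit{id}_A)$. Requirements are obligations of the callers (the history $H$ must satisfy them): each identifier is used by one process, which calls $\mathrm{Add\_Inv}(\mathit{id})$ at most once and then, after it has returned, $\mathrm{Add\_Res}(\mathit{id})$ at most once; queries are called only when both response records have been written. **Collect-based algorithm.** Shared: single-writer multi-reader append-only registers $\mathrm{Reg}[1..N]$ holding sequences of records ($\mathrm{Reg}[i]$ written only by $p_i$), initially empty. - $\mathrm{Add\_Inv}(\mathit{id})$ by $p_i$: append $(I,\mathit{id})$ to $\mathrm{Reg}[i]$ in one atomic write. - $\mathrm{Add\_Res}(\mathit{id})$ by $p_i$: perform a collect, i.e. read all registers $\mathrm{Reg}[1],\dots,\mathrm{Reg}[N]$ one at a time (each read atomic, the whole non-atomic, in no particular prescribed order), and let the view $v$ be the union of the sets of records read; then append $(R,\mathit{id},v)$ to $\mathrm{Reg}[i]$ in one atomic write. - $\mathrm{Precedes}(A,B)$: let $v_A,v_B$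 be the views stored with the response records of $A$ and $B$; return the conjunction of $(R,A)\in v_B$, $(I,B)\notin v_A$, and $v_A\subseteq v_B$. Here $(R,A)\in v_B$ means that $v_B$ contains the response record of $A$. *)

theory Defs
  imports Main "HOL-Library.Extended_Nat" "HOL-Library.FSet"
begin

section \<open>Histories\<close>

type_synonym proc = nat

datatype 'id operation =
    Add_Inv 'id
  | Add_Res 'id
  | Precedes 'id 'id
  | Concurrent 'id 'id

datatype ret = Ack | Truth bool

datatype 'id event =
    Invocation proc "'id operation"
  | Response proc ret

type_synonym 'id history = "'id event list"

fun proc_of :: "'id event \<Rightarrow> proc" where
  "proc_of (Invocation p a) = p"
| "proc_of (Response p r) = p"

definition proj :: "'id history \<Rightarrow> proc \<Rightarrow> 'id history" where
  "proj H p = filter (\<lambda>e. proc_of e = p) H"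

fun alternating :: "'id history \<Rightarrow> bool" where
  "alternating [] = True"
| "alternating [Invocation p a] = True"
| "alternating (Invocation p a # Response q r # es) = (p = q \<and> alternating es)"
| "alternating _ = False"

text \<open>Processes are sequential, so the invocation matching a response is the immediately
  preceding event of the same process.\<close>

definition well_formed :: "'id history \<Rightarrow> bool" where
  "well_formed H \<longleftrightarrow> (\<forall>p. alternating (proj H p))"

text \<open>For a well-formed history an invocation is pending iff its process has no later response.\<close>

fun drop_pending :: "'id history \<Rightarrow> 'id history" where
  "drop_pending [] = []"
| "drop_pending (Invocation p a # es) =
     (if \<exists>r. Response p r \<in> set es then Invocation p a # drop_pending es else drop_pending es)"
| "drop_pending (Response p r # es) = Response p r # drop_pending es"

text \<open>Some pending operations are completed, by the responses in \<open>E\<close>; the others are dropped.\<close>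

definition completion :: "'id history \<Rightarrow> 'id history \<Rightarrow> bool" where
  "completion H H' \<longleftrightarrow>
     (\<exists>E. (\<forall>e \<in> set E. \<exists>p r. e = Response p r) \<and> well_formed (H @ E) \<and> H' = drop_pending (H @ E))"

text \<open>A sequential history is given by its list of complete operations, each with its process and
  its return value.\<close>

type_synonym 'id seq_history = "(proc \<times> 'id operation \<times> ret) list"

definition events :: "'id seq_history \<Rightarrow> 'id history" where
  "events S = concat (map (\<lambda>(p, a, r). [Invocation p a, Response p r]) S)"

text \<open>Same operations with the same results, and, since the projections are lists, in the same
  order for each process: preservation of program order is part of equivalence.\<close>

definition equivalent :: "'id history \<Rightarrow> 'id history \<Rightarrow> bool" where
  "equivalent H H' \<longleftrightarrow> (\<forall>p. proj H p = proj H' p)"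

text \<open>The pair \<open>(p, k)\<close> denotes the operation of process \<open>p\<close> that comes after exactly \<open>k\<close> other
  operations of \<open>p\<close>. Equivalence preserves this numbering.\<close>

type_synonym op_ref = "proc \<times> nat"

definition invoked_at :: "'id history \<Rightarrow> op_ref \<Rightarrow> nat \<Rightarrow> bool" where
  "invoked_at H = (\<lambda>(p, k) i. i < length H \<and> (\<exists>a. H ! i = Invocation p a) \<and>
     length (filter (\<lambda>e. \<exists>a. e = Invocation p a) (take i H)) = k)"

definition responded_at :: "'id history \<Rightarrow> op_ref \<Rightarrow> nat \<Rightarrow> bool" where
  "responded_at H = (\<lambda>(p, k) i. i < length H \<and> (\<exists>r. H ! i = Response p r) \<and>
     length (filter (\<lambda>e. \<exists>r. e = Response p r) (take i H)) = k)"

definition real_time_before :: "'id history \<Rightarrow> op_ref \<Rightarrow> op_ref \<Rightarrow> bool" where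
  "real_time_before H x y \<longleftrightarrow> (\<exists>i j. responded_at H x i \<and> invoked_at H y j \<and> i < j)"


section \<open>Correctness conditions\<close>

text \<open>A sequential specification is the set of its legal sequential histories; an implementation
  is the set of histories it produces.\<close>

definition prefix_closed :: "'id seq_history set \<Rightarrow> bool" where
  "prefix_closed Spec \<longleftrightarrow> (\<forall>S T. S @ T \<in> Spec \<longrightarrow> S \<in> Spec)"

definition serialization :: "'id seq_history set \<Rightarrow> 'id history \<Rightarrow> 'id seq_history \<Rightarrow> bool" where
  "serialization Spec H S \<longleftrightarrow>
     S \<in> Spec \<and> (\<exists>H'. completion H H' \<and> equivalent H' (events S))"

definition sequentially_consistent :: "'id seq_history set \<Rightarrow> 'id history set \<Rightarrow> bool" where
  "sequentially_consistent Spec Impl \<longleftrightarrow>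
     (\<forall>H \<in> Impl. well_formed H \<longrightarrow> (\<exists>S. serialization Spec H S))"

text \<open>The condition \<open>invoked_at (events S) y j\<close> exempts the pending operations that \<open>S\<close> drops.\<close>

definition linearizable :: "'id seq_history set \<Rightarrow> 'id history set \<Rightarrow> bool" where
  "linearizable Spec Impl \<longleftrightarrow>
     (\<forall>H \<in> Impl. well_formed H \<longrightarrow>
       (\<exists>S. serialization Spec H S \<and>
         (\<forall>x y. real_time_before H x y \<and> (\<exists>j. invoked_at (events S) y j) \<longrightarrow>
           real_time_before (events S) x y)))"


section \<open>Sequential specification of the Causal Monitor\<close>

datatype tag = TagI | TagR

type_synonym 'id cm_state = "(tag \<times> 'id) list"

definition idx :: "'a \<Rightarrow> 'a list \<Rightarrow> enat" where
  "idx e s = (if e \<in> set s then enat (LEAST i. i < length s \<and> s ! i = e) else \<infinity>)"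

fun cm_requires :: "'id cm_state \<Rightarrow> 'id operation \<Rightarrow> bool" where
  "cm_requires s (Add_Inv x) \<longleftrightarrow> (TagI, x) \<notin> set s"
| "cm_requires s (Add_Res x) \<longleftrightarrow> (TagI, x) \<in> set s \<and> (TagR, x) \<notin> set s"
| "cm_requires s (Precedes x y) \<longleftrightarrow> (TagR, x) \<in> set s \<and> (TagR, y) \<in> set s"
| "cm_requires s (Concurrent x y) \<longleftrightarrow> (TagR, x) \<in> set s \<and> (TagR, y) \<in> set s"

fun cm_next :: "'id cm_state \<Rightarrow> 'id operation \<Rightarrow> 'id cm_state" where
  "cm_next s (Add_Inv x) = s @ [(TagI, x)]"
| "cm_next s (Add_Res x) = s @ [(TagR, x)]"
| "cm_next s (Precedes x y) = s"
| "cm_next s (Concurrent x y) = s"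

definition cm_precedes :: "'id cm_state \<Rightarrow> 'id \<Rightarrow> 'id \<Rightarrow> bool" where
  "cm_precedes s x y \<longleftrightarrow> idx (TagR, x) s < idx (TagI, y) s"

fun cm_return :: "'id cm_state \<Rightarrow> 'id operation \<Rightarrow> ret" where
  "cm_return s (Add_Inv x) = Ack"
| "cm_return s (Add_Res x) = Ack"
| "cm_return s (Precedes x y) = Truth (cm_precedes s x y)"
| "cm_return s (Concurrent x y) = Truth (\<not> cm_precedes s x y \<and> \<not> cm_precedes s y x)"

fun cm_legal_from :: "'id cm_state \<Rightarrow> 'id seq_history \<Rightarrow> bool" where
  "cm_legal_from s [] \<longleftrightarrow> True"
| "cm_legal_from s ((p, a, r) # S) \<longleftrightarrow>
     cm_requires s a \<and> r = cm_return s a \<and> cm_legal_from (cm_next s a) S"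

definition causal_monitor :: "'id seq_history set" where
  "causal_monitor = {S. cm_legal_from [] S}"

lemma prefix_closed_causal_monitor: "prefix_closed causal_monitor"
proof -
  have "cm_legal_from s (S @ T) \<Longrightarrow> cm_legal_from s S" for s :: "'a cm_state" and S T
    by (induction s S rule: cm_legal_from.induct) auto
  then show ?thesis
    by (auto simp: prefix_closed_def causal_monitor_def)
qed


section \<open>The collect-based algorithm\<close>

text \<open>A response record contains a view, which is itself a finite set of records.\<close>

datatype 'id entry =
    Inv_Entry 'id
  | Res_Entry 'id "'id entry fset"

type_synonym 'id view = "'id entry fset"
type_synonym 'id registers = "proc \<Rightarrow> 'id entry list"

definition precedes_test :: "'id \<Rightarrow> 'id view \<Rightarrow> 'id \<Rightarrow> 'id view \<Rightarrow> bool" where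
  "precedes_test x vx y vy \<longleftrightarrow>
     (\<exists>v. Res_Entry x v |\<in>| vy) \<and> Inv_Entry y |\<notin>| vx \<and> vx |\<subseteq>| vy"

text \<open>Local control state of a process. \<open>Collecting x D v\<close>: inside \<open>Add_Res x\<close>, the registers in
  \<open>D\<close> have been read and \<open>v\<close> is the union of what was read. \<open>Querying x y vx vy\<close>: inside
  \<open>Precedes x y\<close>, with the views fetched so far. \<open>Returning r\<close>: about to respond.\<close>

datatype 'id local_state =
    Idle
  | Writing_Inv 'id
  | Collecting 'id "proc set" "'id view"
  | Querying 'id 'id "'id view option" "'id view option"
  | Returning ret

definition written :: "nat \<Rightarrow> 'id registers \<Rightarrow> 'id \<Rightarrow> bool" where
  "written N Reg x \<longleftrightarrow> (\<exists>j \<in> {1..N}. \<exists>v. Res_Entry x v \<in> set (Reg j))"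

text \<open>Obligations of the callers, for a call by an idle process \<open>p\<close> after the history \<open>H\<close>. As \<open>p\<close>
  is idle, an \<open>Add_Inv x\<close> that it has invoked has returned.\<close>

fun may_call :: "nat \<Rightarrow> 'id history \<Rightarrow> 'id registers \<Rightarrow> proc \<Rightarrow> 'id operation \<Rightarrow> bool" where
  "may_call N H Reg p (Add_Inv x) \<longleftrightarrow> (\<forall>q. Invocation q (Add_Inv x) \<notin> set H)"
| "may_call N H Reg p (Add_Res x) \<longleftrightarrow>
     Invocation p (Add_Inv x) \<in> set H \<and> Invocation p (Add_Res x) \<notin> set H"
| "may_call N H Reg p (Precedes x y) \<longleftrightarrow> written N Reg x \<and> written N Reg y"
| "may_call N H Reg p (Concurrent x y) \<longleftrightarrow> written N Reg x \<and> written N Reg y"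

text \<open>\<open>collect_run N H Reg L\<close>: some execution with processes and registers \<open>1, \<dots>, N\<close> produces
  the history \<open>H\<close> and leads to the register contents \<open>Reg\<close> and the local states \<open>L\<close>. Each rule is
  one event or one atomic step. The algorithm prescribes no code for \<open>Concurrent\<close>, so this
  operation is never invoked here; adding code for it would only add histories.\<close>

inductive collect_run ::
    "nat \<Rightarrow> 'id history \<Rightarrow> 'id registers \<Rightarrow> (proc \<Rightarrow> 'id local_state) \<Rightarrow> bool"
  for N :: nat where
  init:
    "collect_run N [] (\<lambda>_. []) (\<lambda>_. Idle)"
| invoke_add_inv:
    "\<lbrakk>collect_run N H Reg L; p \<in> {1..N}; L p = Idle; may_call N H Reg p (Add_Inv x)\<rbrakk>
     \<Longrightarrow> collect_run N (H @ [Invocation p (Add_Inv x)]) Reg (L(p := Writing_Inv x))"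
| write_inv:
    "\<lbrakk>collect_run N H Reg L; p \<in> {1..N}; L p = Writing_Inv x\<rbrakk>
     \<Longrightarrow> collect_run N H (Reg(p := Reg p @ [Inv_Entry x])) (L(p := Returning Ack))"
| invoke_add_res:
    "\<lbrakk>collect_run N H Reg L; p \<in> {1..N}; L p = Idle; may_call N H Reg p (Add_Res x)\<rbrakk>
     \<Longrightarrow> collect_run N (H @ [Invocation p (Add_Res x)]) Reg (L(p := Collecting x {} {||}))"
| collect_read:
    "\<lbrakk>collect_run N H Reg L; p \<in> {1..N}; L p = Collecting x D v; j \<in> {1..N}; j \<notin> D\<rbrakk>
     \<Longrightarrow> collect_run N H Reg (L(p := Collecting x (insert j D) (v |\<union>| fset_of_list (Reg j))))"
| write_res:
    "\<lbrakk>collect_run N H Reg L; p \<in> {1..N}; L p = Collecting x D v; D = {1..N}\<rbrakk>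
     \<Longrightarrow> collect_run N H (Reg(p := Reg p @ [Res_Entry x v])) (L(p := Returning Ack))"
| invoke_precedes:
    "\<lbrakk>collect_run N H Reg L; p \<in> {1..N}; L p = Idle; may_call N H Reg p (Precedes x y)\<rbrakk>
     \<Longrightarrow> collect_run N (H @ [Invocation p (Precedes x y)]) Reg (L(p := Querying x y None None))"
| fetch_left:
    "\<lbrakk>collect_run N H Reg L; p \<in> {1..N}; L p = Querying x y None vy;
      j \<in> {1..N}; Res_Entry x v \<in> set (Reg j)\<rbrakk>
     \<Longrightarrow> collect_run N H Reg (L(p := Querying x y (Some v) vy))"
| fetch_right:
    "\<lbrakk>collect_run N H Reg L; p \<in> {1..N}; L p = Querying x y vx None;
      j \<in> {1..N}; Res_Entry y v \<in> set (Reg j)\<rbrakk>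
     \<Longrightarrow> collect_run N H Reg (L(p := Querying x y vx (Some v)))"
| evaluate:
    "\<lbrakk>collect_run N H Reg L; p \<in> {1..N}; L p = Querying x y (Some vx) (Some vy)\<rbrakk>
     \<Longrightarrow> collect_run N H Reg (L(p := Returning (Truth (precedes_test x vx y vy))))"
| respond:
    "\<lbrakk>collect_run N H Reg L; p \<in> {1..N}; L p = Returning r\<rbrakk>
     \<Longrightarrow> collect_run N (H @ [Response p r]) Reg (L(p := Idle))"

definition collect_histories :: "nat \<Rightarrow> 'id history set" where
  "collect_histories N = {H. \<exists>Reg L. collect_run N H Reg L}"

end

theory Submission
  imports Defs
begin

text \<open>Atomicity of the individual reads does not prevent two collects from disagreeing on the order
  of two writes. Processes 1 and 2 run the collects of \<open>Add_Res a\<close> and \<open>Add_Res c\<close> while processes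
  3 and 4 write the invocation records of \<open>b\<close> and \<open>d\<close>. The first collect reads register 3 before
  and register 4 after these writes, the second one the other way round. So \<open>v\<^sub>a\<close> contains
  \<open>(I, d)\<close> but not \<open>(I, b)\<close>, and \<open>v\<^sub>c\<close> contains \<open>(I, b)\<close> but not \<open>(I, d)\<close>. The collects for \<open>b\<close> and
  \<open>d\<close> come last and see everything. Hence \<open>Precedes a b\<close> and \<open>Precedes c d\<close> return true, while
  \<open>Precedes a d\<close> and \<open>Precedes c b\<close> return false. A legal sequential history with these answers
  would have the cycle \<open>R\<^sub>a < I\<^sub>b \<le> R\<^sub>c < I\<^sub>d \<le> R\<^sub>a\<close>: the answers form the poset \<open>2 + 2\<close>, which is not
  an interval order.\<close>

section \<open>Answers in legal sequential histories\<close>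

lemma idx_append: "e \<in> set s \<Longrightarrow> idx e (s @ t) = idx e s"
proof -
  assume e: "e \<in> set s"
  then obtain k where k: "k < length s" "s ! k = e"
    by (auto simp: in_set_conv_nth)
  define m where "m = (LEAST i. i < length s \<and> s ! i = e)"
  have m: "m < length s" "s ! m = e"
    using LeastI[of "\<lambda>i. i < length s \<and> s ! i = e" k] k by (auto simp: m_def)
  have "(LEAST i. i < length (s @ t) \<and> (s @ t) ! i = e) = m"
  proof (rule Least_equality)
    show "m < length (s @ t) \<and> (s @ t) ! m = e"
      using m by (simp add: nth_append)
  next
    fix i assume i: "i < length (s @ t) \<and> (s @ t) ! i = e"
    show "m \<le> i"
    proof (cases "i < length s")
      case True
      then show ?thesis
        using i unfolding m_def by (intro Least_le) (simp add: nth_append)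
    qed (use m in simp)
  qed
  then show ?thesis
    using e by (simp add: idx_def m_def)
qed

lemma cm_precedes_append:
  "(TagR, x) \<in> set s \<Longrightarrow> (TagI, y) \<in> set s \<Longrightarrow> cm_precedes (s @ t) x y = cm_precedes s x y"
  by (simp add: cm_precedes_def idx_append)

definition cm_final :: "'id cm_state \<Rightarrow> 'id seq_history \<Rightarrow> 'id cm_state" where
  "cm_final s S = foldl cm_next s (map (fst \<circ> snd) S)"

lemma cm_final_extends: "\<exists>t. cm_final s S = s @ t"
proof (induction S arbitrary: s)
  case Nil
  then show ?case by (simp add: cm_final_def)
next
  case (Cons e S)
  obtain p a r where e: "e = (p, a, r)" by (cases e)
  obtain t where "cm_final (cm_next s a) S = cm_next s a @ t"
    using Cons by blast
  then show ?case
    by (cases a) (auto simp: cm_final_def e)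
qed

text \<open>States grow only by appending, so the positions of records already present are fixed,
  and a query gets the answer that the final state would give. The last assumption is an invariant
  of legal steps; it supplies \<open>(TagI, y)\<close> from the required
  \<open>(TagR, y)\<close>.\<close>

lemma legal_answer_final:
  assumes "cm_legal_from s S" "(p, Precedes x y, Truth t) \<in> set S"
    and "\<And>z. (TagR, z) \<in> set s \<Longrightarrow> (TagI, z) \<in> set s"
  shows "t \<longleftrightarrow> cm_precedes (cm_final s S) x y"
  using assms
proof (induction S arbitrary: s)
  case Nil
  then show ?case by simp
next
  case (Cons e S)
  obtain q a r where e: "e = (q, a, r)" by (cases e)
  have final: "cm_final s (e # S) = cm_final (cm_next s a) S"
    by (simp add: cm_final_def e)
  show ?case
  proof (cases "e = (p, Precedes x y, Truth t)")
    case True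
    then have "(TagR, x) \<in> set s" "(TagI, y) \<in> set s" "t = cm_precedes s x y"
      using Cons.prems by auto
    then show ?thesis
      using cm_final_extends[of s "e # S"] by (auto simp: cm_precedes_append)
  next
    case False
    have "(TagI, z) \<in> set (cm_next s a)" if "(TagR, z) \<in> set (cm_next s a)" for z
      using that Cons.prems by (cases a) (auto simp: e)
    then show ?thesis
      unfolding final using Cons.IH[of "cm_next s a"] Cons.prems False by (auto simp: e)
  qed
qed

text \<open>All four answers can be read in the same final state, whenever and by whomever the
  queries are made. The positions then form a strict cycle in the linear order
  \<open>enat\<close>.\<close>

lemma no_two_plus_two:
  assumes "S \<in> causal_monitor"
    and "(p1, Precedes a b, Truth True) \<in> set S" "(p2, Precedes a d, Truth False) \<in> set S"
    and "(p3, Precedes c d, Truth True) \<in> set S" "(p4, Precedes c b, Truth False) \<in> set S"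
  shows False
proof -
  have "t \<longleftrightarrow> cm_precedes (cm_final [] S) x y"
    if "(p, Precedes x y, Truth t) \<in> set S" for p x y t
    using legal_answer_final[of "[]" S p x y t] assms(1) that by (simp add: causal_monitor_def)
  from this[OF assms(2)] this[OF assms(3)] this[OF assms(4)] this[OF assms(5)]
  show False
    by (auto simp: cm_precedes_def not_less)
qed

section \<open>Complete histories\<close>

text \<open>Even length means that the last invocation is already answered, so the check of the rest
  starts afresh.\<close>

lemma alternating_append:
  "alternating xs \<Longrightarrow> even (length xs) \<Longrightarrow> alternating (xs @ ys) = alternating ys"
  by (induction xs rule: alternating.induct) auto

text \<open>The first response in a nonempty \<open>E\<close> would follow an alternating projection
  of even length and so have no invocation to match.\<close>

lemma completion_complete:
  assumes H: "completion H H'" and "\<And>p. even (length (proj H p))"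
    and "well_formed H" "drop_pending H = H"
  shows "H' = H"
proof -
  obtain E where E: "\<And>e. e \<in> set E \<Longrightarrow> \<exists>p r. e = Response p r"
    and wf: "well_formed (H @ E)" and H': "H' = drop_pending (H @ E)"
    using H unfolding completion_def by blast
  have "E = []"
  proof (cases E)
    case (Cons e E')
    then obtain p r where "e = Response p r"
      using E[of e] by (auto simp: Cons)
    then have "proj (H @ E) p = proj H p @ Response p r # proj E' p"
      by (simp add: proj_def Cons)
    moreover have "alternating (proj (H @ E) p)" "alternating (proj H p)"
      using wf \<open>well_formed H\<close> by (auto simp: well_formed_def)
    ultimately show ?thesis
      using alternating_append[of "proj H p" "Response p r # proj E' p"] assms(2) by simp
  qed
  then show ?thesis
    using H' assms(4) by simp
qed

lemma proj_events: "proj (events S) p = events (filter (\<lambda>e. fst e = p) S)"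
  by (induction S) (auto simp: proj_def events_def)

lemma events_inject: "events S = events T \<longleftrightarrow> S = T"
proof (induction S arbitrary: T)
  case Nil
  then show ?case by (cases T) (auto simp: events_def)
next
  case (Cons e S)
  then show ?case by (cases T) (auto simp: events_def split: prod.splits)
qed

section \<open>Runs of the collect-based algorithm\<close>

lemma collect_run_add_inv:
  assumes "collect_run N H Reg L" "p \<in> {1..N}" "L p = Idle" "may_call N H Reg p (Add_Inv x)"
  shows "collect_run N (H @ [Invocation p (Add_Inv x), Response p Ack])
    (Reg(p := Reg p @ [Inv_Entry x])) L"
proof -
  have "collect_run N (H @ [Invocation p (Add_Inv x)]) (Reg(p := Reg p @ [Inv_Entry x]))
    (L(p := Returning Ack))"
    using write_inv[OF invoke_add_inv[OF assms] assms(2)] by simp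
  from respond[OF this assms(2)] assms(3) show ?thesis
    by (simp add: fun_upd_idem)
qed

text \<open>The registers stay fixed during these consecutive reads; the list \<open>js\<close>
  chooses their order, which the algorithm leaves open.\<close>

lemma collect_run_reads:
  assumes "collect_run N H Reg L" "p \<in> {1..N}" "L p = Collecting x D v"
    and "distinct js" "set js \<subseteq> {1..N} - D"
  shows "collect_run N H Reg
    (L(p := Collecting x (D \<union> set js) (v |\<union>| fset_of_list (concat (map Reg js)))))"
  using assms
proof (induction js arbitrary: L D v)
  case Nil
  then show ?case by (simp add: fun_upd_idem)
next
  case (Cons j js)
  have run: "collect_run N H Reg (L(p := Collecting x (insert j D) (v |\<union>| fset_of_list (Reg j))))"
    using Cons.prems by (intro collect_read) auto
  have "distinct js" "set js \<subseteq> {1..N} - insert j D"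
    using Cons.prems(4,5) by auto
  from Cons.IH[OF run Cons.prems(2) fun_upd_same this] show ?case
    by (simp add: sup_assoc cong: if_cong)
qed

text \<open>A collect is cut in two so that other processes can write between its halves; the
  counterexample lives on such interruptions.\<close>

lemma collect_run_begin_add_res:
  assumes "collect_run N H Reg L" "p \<in> {1..N}" "L p = Idle" "may_call N H Reg p (Add_Res x)"
    and "distinct js" "set js \<subseteq> {1..N}"
  shows "collect_run N (H @ [Invocation p (Add_Res x)]) Reg
    (L(p := Collecting x (set js) (fset_of_list (concat (map Reg js)))))"
  using collect_run_reads[OF invoke_add_res[OF assms(1-4)] assms(2) _ assms(5)] assms(6)
  by simp

lemma collect_run_end_add_res:
  assumes "collect_run N H Reg L" "p \<in> {1..N}" "L p = Collecting x D v"
    and "distinct js" "D \<inter> set js = {}" "D \<union> set js = {1..N}"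
  shows "collect_run N (H @ [Response p Ack])
    (Reg(p := Reg p @ [Res_Entry x (v |\<union>| fset_of_list (concat (map Reg js)))])) (L(p := Idle))"
proof -
  have "set js \<subseteq> {1..N} - D"
    using assms(5,6) by blast
  from collect_run_reads[OF assms(1-4) this]
  have "collect_run N H Reg
    (L(p := Collecting x {1..N} (v |\<union>| fset_of_list (concat (map Reg js)))))"
    by (simp add: assms(6))
  from write_res[OF this assms(2)]
  have "collect_run N H
    (Reg(p := Reg p @ [Res_Entry x (v |\<union>| fset_of_list (concat (map Reg js)))]))
    (L(p := Returning Ack))"
    by simp
  from respond[OF this assms(2)] show ?thesis
    by simp
qed

lemma collect_run_add_res:
  assumes "collect_run N H Reg L" "p \<in> {1..N}" "L p = Idle" "may_call N H Reg p (Add_Res x)"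
    and "distinct js" "set js = {1..N}"
  shows "collect_run N (H @ [Invocation p (Add_Res x), Response p Ack])
    (Reg(p := Reg p @ [Res_Entry x (fset_of_list (concat (map Reg js)))])) L"
  \<comment> \<open>With \<open>[]\<close> for the second half, all reads happen in the first: the
    collect is uninterrupted.\<close>
  using collect_run_end_add_res[OF collect_run_begin_add_res[OF assms(1-5)] assms(2), of _ _ _ "[]"]
    assms(3,6)
  by (simp add: fun_upd_idem)

lemma collect_run_precedes:
  assumes "collect_run N H Reg L" "p \<in> {1..N}" "L p = Idle"
    and x: "i \<in> {1..N}" "Res_Entry x vx \<in> set (Reg i)"
    and y: "j \<in> {1..N}" "Res_Entry y vy \<in> set (Reg j)"
    and t: "precedes_test x vx y vy = t"
  shows "collect_run N (H @ [Invocation p (Precedes x y), Response p (Truth t)]) Reg L"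
proof -
  have "may_call N H Reg p (Precedes x y)"
    using x y by (auto simp: written_def)
  from invoke_precedes[OF assms(1-3) this]
  have "collect_run N (H @ [Invocation p (Precedes x y)]) Reg (L(p := Querying x y None None))" .
  from fetch_left[OF this assms(2) _ x, of y None]
  have "collect_run N (H @ [Invocation p (Precedes x y)]) Reg
    (L(p := Querying x y (Some vx) None))"
    by simp
  from fetch_right[OF this assms(2) _ y, of x "Some vx"]
  have "collect_run N (H @ [Invocation p (Precedes x y)]) Reg
    (L(p := Querying x y (Some vx) (Some vy)))"
    by simp
  from evaluate[OF this assms(2), of x y vx vy]
  have "collect_run N (H @ [Invocation p (Precedes x y)]) Reg (L(p := Returning (Truth t)))"
    by (simp add: t)
  from respond[OF this assms(2)] assms(3) show ?thesis
    by (simp add: fun_upd_idem)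
qed

section \<open>The counterexample\<close>

text \<open>Reads and writes leave no trace in a history; this one only makes room for them, by
  letting \<open>Add_Res a\<close> and \<open>Add_Res c\<close> overlap \<open>Add_Inv b\<close> and
  \<open>Add_Inv d\<close>. Process 1 asks all queries, so a single projection carries the four
  answers.\<close>

definition crossed_history :: "'id \<Rightarrow> 'id \<Rightarrow> 'id \<Rightarrow> 'id \<Rightarrow> 'id history" where
  "crossed_history a b c d =
    [Invocation 1 (Add_Inv a), Response 1 Ack, Invocation 2 (Add_Inv c), Response 2 Ack,
     Invocation 1 (Add_Res a), Invocation 2 (Add_Res c),
     Invocation 3 (Add_Inv b), Response 3 Ack, Invocation 4 (Add_Inv d), Response 4 Ack,
     Response 1 Ack, Response 2 Ack,
     Invocation 3 (Add_Res b), Response 3 Ack, Invocation 4 (Add_Res d), Response 4 Ack,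
     Invocation 1 (Precedes a b), Response 1 (Truth True),
     Invocation 1 (Precedes a d), Response 1 (Truth False),
     Invocation 1 (Precedes c d), Response 1 (Truth True),
     Invocation 1 (Precedes c b), Response 1 (Truth False)]"

lemma crossed_history_produced:
  assumes "distinct [a, b, c, d]"
  shows "crossed_history a b c d \<in> collect_histories 4"
proof -
  have procs: "{Suc 0..4} = {1, 2, 3, 4}"
    by auto
  have "a \<noteq> b" "a \<noteq> c" "a \<noteq> d" "b \<noteq> c" "b \<noteq> d" "c \<noteq> d"
    using assms by auto
  note ids = this this[symmetric]
  define va where "va = {|Inv_Entry a, Inv_Entry c, Inv_Entry d|}"
  define vc where "vc = {|Inv_Entry a, Inv_Entry c, Inv_Entry b|}"
  define vb where "vb = {|Inv_Entry a, Res_Entry a va, Inv_Entry c, Res_Entry c vc,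
    Inv_Entry b, Inv_Entry d|}"
  \<comment> \<open>Process 4 collects after process 3 has written its response record, hence the
    additional element.\<close>
  define vd where "vd = finsert (Res_Entry b vb) vb"
  define Reg :: "'a registers" where "Reg = (\<lambda>_. [])(
    1 := [Inv_Entry a, Res_Entry a va], 2 := [Inv_Entry c, Res_Entry c vc],
    3 := [Inv_Entry b, Res_Entry b vb], 4 := [Inv_Entry d, Res_Entry d vd])"
  have "collect_run 4 [Invocation 1 (Add_Inv a), Response 1 Ack]
    ((\<lambda>_. [])(1 := [Inv_Entry a])) (\<lambda>_. Idle)"
    using collect_run_add_inv[OF init, of 1 4 a] by simp
  from collect_run_add_inv[OF this, of 2 c]
  have "collect_run 4 (take 4 (crossed_history a b c d))
    ((\<lambda>_. [])(1 := [Inv_Entry a], 2 := [Inv_Entry c])) (\<lambda>_. Idle)"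
    by (simp add: crossed_history_def ids)
  \<comment> \<open>Register 3 is still empty, so this collect misses \<open>b\<close>; register 4
    is left for later.\<close>
  from collect_run_begin_add_res[OF this, of 1 a "[1, 2, 3]"]
  have "collect_run 4 (take 5 (crossed_history a b c d))
    ((\<lambda>_. [])(1 := [Inv_Entry a], 2 := [Inv_Entry c]))
    ((\<lambda>_. Idle)(1 := Collecting a {1, 2, 3} {|Inv_Entry a, Inv_Entry c|}))"
    by (simp add: crossed_history_def ids)
  \<comment> \<open>The mirror image: \<open>d\<close> is missed and register 3 is left for
    later.\<close>
  from collect_run_begin_add_res[OF this, of 2 c "[1, 2, 4]"]
  have "collect_run 4 (take 6 (crossed_history a b c d))
    ((\<lambda>_. [])(1 := [Inv_Entry a], 2 := [Inv_Entry c]))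
    ((\<lambda>_. Idle)(1 := Collecting a {1, 2, 3} {|Inv_Entry a, Inv_Entry c|},
                2 := Collecting c {1, 2, 4} {|Inv_Entry a, Inv_Entry c|}))"
    by (simp add: crossed_history_def ids)
  from collect_run_add_inv[OF this, of 3 b]
  have "collect_run 4 (take 8 (crossed_history a b c d))
    ((\<lambda>_. [])(1 := [Inv_Entry a], 2 := [Inv_Entry c], 3 := [Inv_Entry b]))
    ((\<lambda>_. Idle)(1 := Collecting a {1, 2, 3} {|Inv_Entry a, Inv_Entry c|},
                2 := Collecting c {1, 2, 4} {|Inv_Entry a, Inv_Entry c|}))"
    by (simp add: crossed_history_def ids)
  from collect_run_add_inv[OF this, of 4 d]
  have "collect_run 4 (take 10 (crossed_history a b c d))
    ((\<lambda>_. [])(1 := [Inv_Entry a], 2 := [Inv_Entry c], 3 := [Inv_Entry b], 4 := [Inv_Entry d]))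
    ((\<lambda>_. Idle)(1 := Collecting a {1, 2, 3} {|Inv_Entry a, Inv_Entry c|},
                2 := Collecting c {1, 2, 4} {|Inv_Entry a, Inv_Entry c|}))"
    by (simp add: crossed_history_def ids)
  from collect_run_end_add_res[OF this, of 1 a "{1, 2, 3}" "{|Inv_Entry a, Inv_Entry c|}" "[4]"]
  have "collect_run 4 (take 11 (crossed_history a b c d))
    ((\<lambda>_. [])(1 := [Inv_Entry a, Res_Entry a va], 2 := [Inv_Entry c],
              3 := [Inv_Entry b], 4 := [Inv_Entry d]))
    ((\<lambda>_. Idle)(2 := Collecting c {1, 2, 4} {|Inv_Entry a, Inv_Entry c|}))"
    by (simp add: crossed_history_def ids procs va_def fun_upd_twist fun_upd_idem insert_commute finsert_commute)
  \<comment> \<open>Register 1 was read before \<open>Res_Entry a va\<close> was written there, so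
    \<open>vc\<close> lacks that record.\<close>
  from collect_run_end_add_res[OF this, of 2 c "{1, 2, 4}" "{|Inv_Entry a, Inv_Entry c|}" "[3]"]
  have "collect_run 4 (take 12 (crossed_history a b c d))
    ((\<lambda>_. [])(1 := [Inv_Entry a, Res_Entry a va], 2 := [Inv_Entry c, Res_Entry c vc],
              3 := [Inv_Entry b], 4 := [Inv_Entry d])) (\<lambda>_. Idle)"
    by (simp add: crossed_history_def ids procs vc_def fun_upd_twist fun_upd_idem insert_commute finsert_commute)
  from collect_run_add_res[OF this, of 3 b "[1, 2, 3, 4]"]
  have "collect_run 4 (take 14 (crossed_history a b c d))
    ((\<lambda>_. [])(1 := [Inv_Entry a, Res_Entry a va], 2 := [Inv_Entry c, Res_Entry c vc],
              3 := [Inv_Entry b, Res_Entry b vb], 4 := [Inv_Entry d])) (\<lambda>_. Idle)"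
    by (simp add: crossed_history_def ids procs vb_def fun_upd_twist)
  from collect_run_add_res[OF this, of 4 d "[1, 2, 3, 4]"]
  have run: "collect_run 4 (take 16 (crossed_history a b c d)) Reg (\<lambda>_. Idle)"
    by (simp add: crossed_history_def ids procs vd_def vb_def Reg_def fun_upd_twist finsert_commute)
  have recs: "Res_Entry a va \<in> set (Reg 1)" "Res_Entry c vc \<in> set (Reg 2)"
    "Res_Entry b vb \<in> set (Reg 3)" "Res_Entry d vd \<in> set (Reg 4)"
    by (simp_all add: Reg_def)
  \<comment> \<open>Both \<open>vb\<close> and \<open>vd\<close> include \<open>va\<close>,
    \<open>vc\<close> and the response records of \<open>a\<close> and \<open>c\<close>, so only the
    test for the invocation record decides.\<close>
  have ab: "precedes_test a va b vb = True" and ad: "precedes_test a va d vd = False"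
    and cd: "precedes_test c vc d vd = True" and cb: "precedes_test c vc b vb = False"
    using ids by (auto simp: precedes_test_def va_def vc_def vb_def vd_def)
  from collect_run_precedes[OF run, of 1, OF _ _ _ recs(1) _ recs(3) ab]
  have "collect_run 4 (take 18 (crossed_history a b c d)) Reg (\<lambda>_. Idle)"
    by (simp add: crossed_history_def)
  from collect_run_precedes[OF this, of 1, OF _ _ _ recs(1) _ recs(4) ad]
  have "collect_run 4 (take 20 (crossed_history a b c d)) Reg (\<lambda>_. Idle)"
    by (simp add: crossed_history_def)
  from collect_run_precedes[OF this, of 1, OF _ _ _ recs(2) _ recs(4) cd]
  have "collect_run 4 (take 22 (crossed_history a b c d)) Reg (\<lambda>_. Idle)"
    by (simp add: crossed_history_def)
  from collect_run_precedes[OF this, of 1, OF _ _ _ recs(2) _ recs(3) cb]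
  have "collect_run 4 (crossed_history a b c d) Reg (\<lambda>_. Idle)"
    by (simp add: crossed_history_def)
  then show ?thesis
    by (auto simp: collect_histories_def)
qed

lemma crossed_history_well_formed: "well_formed (crossed_history a b c d)"
  by (auto simp: well_formed_def proj_def crossed_history_def)

text \<open>No operation is pending, so the only completion is the history itself, and
  \<open>S\<close> has to contain all four answers of process 1.\<close>

lemma crossed_history_not_serializable:
  assumes "S \<in> causal_monitor" "completion (crossed_history a b c d) H'"
    and "equivalent H' (events S)"
  shows False
proof -
  have "even (length (proj (crossed_history a b c d) p))" for p
    by (simp add: proj_def crossed_history_def)
  moreover have "drop_pending (crossed_history a b c d) = crossed_history a b c d"
    by (auto simp: crossed_history_def)
  ultimately have "H' = crossed_history a b c d"
    by (rule completion_complete[OF assms(2) _ crossed_history_well_formed])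
  then have "events (filter (\<lambda>e. fst e = 1) S) = proj (crossed_history a b c d) 1"
    using assms(3) by (simp add: equivalent_def proj_events)
  also have "\<dots> = events [(1, Add_Inv a, Ack), (1, Add_Res a, Ack),
     (1, Precedes a b, Truth True), (1, Precedes a d, Truth False),
     (1, Precedes c d, Truth True), (1, Precedes c b, Truth False)]"
    by (simp add: proj_def crossed_history_def events_def)
  finally have "set (filter (\<lambda>e. fst e = 1) S) = set [(1, Add_Inv a, Ack), (1, Add_Res a, Ack),
     (1, Precedes a b, Truth True), (1, Precedes a d, Truth False),
     (1, Precedes c d, Truth True), (1, Precedes c b, Truth False)]"
    by (simp only: events_inject)
  then have "(1, Precedes a b, Truth True) \<in> set S" "(1, Precedes a d, Truth False) \<in> set S"
    "(1, Precedes c d, Truth True) \<in> set S" "(1, Precedes c b, Truth False) \<in> set S"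
    by auto
  then show False
    by (rule no_two_plus_two[OF assms(1)])
qed

theorem theorem18:
  assumes "infinite (UNIV :: 'id set)"
  shows "\<exists>N.
    (\<exists>H \<in> (collect_histories N :: 'id history set). well_formed H \<and>
      \<not> (\<exists>S \<in> causal_monitor. \<exists>H'. completion H H' \<and> equivalent H' (events S))) \<and>
    \<not> sequentially_consistent causal_monitor (collect_histories N :: 'id history set) \<and>
    \<not> linearizable causal_monitor (collect_histories N :: 'id history set)"
proof -
  obtain A :: "'id set" where "card A = 4" "finite A"
    using infinite_arbitrarily_large[OF assms] by blast
  then obtain xs where "set xs = A" "length xs = 4" "distinct xs"
    using finite_distinct_list distinct_card by metis
  then obtain a b c d :: 'id where "distinct [a, b, c, d]"
    by (auto simp: numeral_eq_Suc length_Suc_conv)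
  then have H: "crossed_history a b c d \<in> collect_histories 4"
    by (rule crossed_history_produced)
  \<comment> \<open>One history refutes both conditions, since \<open>linearizable\<close> also asks
    for a \<open>serialization\<close>.\<close>
  have "\<not> serialization causal_monitor (crossed_history a b c d) S" for S
    using crossed_history_not_serializable by (auto simp: serialization_def)
  then have "\<not> sequentially_consistent causal_monitor (collect_histories 4 :: 'id history set)"
    and "\<not> linearizable causal_monitor (collect_histories 4 :: 'id history set)"
    using H crossed_history_well_formed[of a b c d]
    by (auto simp: sequentially_consistent_def linearizable_def)
  then show ?thesis
    using H crossed_history_well_formed[of a b c d] crossed_history_not_serializable[of _ a b c d]
    by blast
qed

end
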